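(* Let $\sigma$ be either the ramp function $\sigma_R$ or the logistic function $\sigma_\ell$. Let $N,M$ be positive integers and let $\widetilde f:[0,N]\times[0,M]\to\mathbb{R}$ be a digital image function, i.e. $\widetilde f=\sum_{i=1}^N\sum_{j=1}^M F_{i,j}\chi_{i,j}$ with $F_{i,j}\in\{0,1,\dots,255\}$. Then there is a constant $K>0$, independent of $n$, such that for all sufficiently large $n\in\mathbb{N}$ $$|1-\mathrm{cSSIM}(\widetilde f(\cdot),F_n^{\sigma}(\widetilde f,\cdot))|\ \le\ c_f\,255^2\,M\,N\,K\,\frac{\ln n}{n},$$ where $c_f=\frac{4}{\sigma_{\widetilde f}^2+c_2}+\frac{1}{\mu_{\widetilde f}^2+c_1}$.
   Context: The logistic function is $\sigma_\ell(x)=(1+e^{-x})^{-1}$; the ramp function is $\sigma_R(x)=0$ for $x<-\frac12$, $\sigma_R(x)=x+\frac12$ for $-\frac12\le x\le\frac12$, $\sigma_R(x)=1$ for $x>\frac12$. Let $I=[0,N]\times[0,M]$. For $1\le i\le N$, $1\le j\le M$, $\chi_{i,j}$ is the characteristic function of the unit pixel which is the product of $[i-1,i)$ (closed on the right if $i=N$) and $[j-1,j)$ (closed on the right if $j=M$); these pixels partition $I$. Set $\phi_\sigma(x)=\frac12[\sigma(x+1)-\sigma(x-1)]$ for $x\in\mathbb{R}$, $\Psi_\sigma(\mathtt{x})=\phi_\sigma(x_1)\phi_\sigma(x_2)$ for $\mathtt{x}=(x_1,x_2)\in\mathbb{R}^2$, and $\mathcal{A}_n=\{\mathtt{k}\in\mathbb{Z}^2:0\le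 k_1\le nN,\ 0\le k_2\le nM\}$. The neural network operators generated by $\sigma$ are $$F_n^\sigma(f,\mathtt{x})=\frac{\sum_{\mathtt{k}\in\mathcal{A}_n}f(\mathtt{k}/n)\,\Psi_\sigma(n\mathtt{x}-\mathtt{k})}{\sum_{\mathtt{k}\in\mathcal{A}_n}\Psi_\sigma(n\mathtt{x}-\mathtt{k})},\qquad \mathtt{x}\in I,\ \mathtt{k}/n=(k_1/n,k_2/n).$$ Continuous SSIM: fix constants $c_1,c_2>0$ and let $\nu$ be the normalized Lebesgue (probability) measure on $I$. For non-negative $f,g\in L^2(I)$, $$\mathrm{cSSIM}(f,g)=\frac{2\mu_f\mu_g+c_1}{\mu_f^2+\mu_g^2+c_1}\cdot\frac{2\sigma_{fg}+c_2}{\sigma_f^2+\sigma_g^2+c_2},$$ where $\mu_f=\int_I f\,d\nu$, $\sigma_{fg}=\int_I(f-\mu_f)(g-\mu_g)\,d\nu$ and $\sigma_f^2=\sigma_{ff}$ (these indexed symbols are not to be confused with the activation function $\sigma$). *)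

theory Defs
  imports "HOL-Analysis.Analysis"
begin

definition logistic :: "real \<Rightarrow> real" where
  "logistic x = inverse (1 + exp (- x))"

definition ramp :: "real \<Rightarrow> real" where
  "ramp x = (if x < - (1/2) then 0 else if x \<le> 1/2 then x + 1/2 else 1)"

definition phi :: "(real \<Rightarrow> real) \<Rightarrow> real \<Rightarrow> real" where
  "phi \<sigma> x = (1/2) * (\<sigma> (x + 1) - \<sigma> (x - 1))"

definition Psi :: "(real \<Rightarrow> real) \<Rightarrow> real \<times> real \<Rightarrow> real" where
  "Psi \<sigma> x = phi \<sigma> (fst x) * phi \<sigma> (snd x)"

definition image_domain :: "nat \<Rightarrow> nat \<Rightarrow> (real \<times> real) set" where
  "image_domain N M = {0..real N} \<times> {0..real M}"

definition pixel_side :: "nat \<Rightarrow> nat \<Rightarrow> real set" where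
  "pixel_side N i = (if i = N then {real i - 1..real i} else {real i - 1..<real i})"

definition pixel :: "nat \<Rightarrow> nat \<Rightarrow> nat \<Rightarrow> nat \<Rightarrow> (real \<times> real) set" where
  "pixel N M i j = pixel_side N i \<times> pixel_side M j"

text \<open>
  Functions on the rectangle are total functions on the plane of which only the values on
  the rectangle matter; a digital image is unconstrained elsewhere.
\<close>

definition digital_image :: "nat \<Rightarrow> nat \<Rightarrow> (real \<times> real \<Rightarrow> real) \<Rightarrow> bool" where
  "digital_image N M f \<longleftrightarrow>
    (\<exists>F :: nat \<Rightarrow> nat \<Rightarrow> nat.
      (\<forall>i\<in>{1..N}. \<forall>j\<in>{1..M}. F i j \<in> {0..255}) \<and>
      (\<forall>x\<in>image_domain N M.
        f x = (\<Sum>i=1..N. \<Sum>j=1..M. real (F i j) * indicator (pixel N M i j) x)))"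

definition node_set :: "nat \<Rightarrow> nat \<Rightarrow> nat \<Rightarrow> (int \<times> int) set" where
  "node_set N M n = {0..int (n * N)} \<times> {0..int (n * M)}"

definition nn_operator ::
  "(real \<Rightarrow> real) \<Rightarrow> nat \<Rightarrow> nat \<Rightarrow> nat \<Rightarrow> (real \<times> real \<Rightarrow> real) \<Rightarrow> real \<times> real \<Rightarrow> real" where
  "nn_operator \<sigma> N M n f x =
    (\<Sum>(k1, k2)\<in>node_set N M n.
        f (of_int k1 / real n, of_int k2 / real n) *
        Psi \<sigma> (real n * fst x - of_int k1, real n * snd x - of_int k2)) /
    (\<Sum>(k1, k2)\<in>node_set N M n.
        Psi \<sigma> (real n * fst x - of_int k1, real n * snd x - of_int k2))"

text \<open>
  Normalized Lebesgue measure, with the rectangle itself as underlying space, so that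
  neither measurability nor integrals depend on values outside it.
\<close>

definition image_measure :: "nat \<Rightarrow> nat \<Rightarrow> (real \<times> real) measure" where
  "image_measure N M = uniform_measure (lebesgue_on (image_domain N M)) (image_domain N M)"

definition img_mean :: "nat \<Rightarrow> nat \<Rightarrow> (real \<times> real \<Rightarrow> real) \<Rightarrow> real" where
  "img_mean N M f = (LINT x|image_measure N M. f x)"

definition img_cov ::
  "nat \<Rightarrow> nat \<Rightarrow> (real \<times> real \<Rightarrow> real) \<Rightarrow> (real \<times> real \<Rightarrow> real) \<Rightarrow> real" where
  "img_cov N M f g =
    (LINT x|image_measure N M. (f x - img_mean N M f) * (g x - img_mean N M g))"

definition img_var :: "nat \<Rightarrow> nat \<Rightarrow> (real \<times> real \<Rightarrow> real) \<Rightarrow> real" where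
  "img_var N M f = img_cov N M f f"

definition cSSIM ::
  "real \<Rightarrow> real \<Rightarrow> nat \<Rightarrow> nat \<Rightarrow> (real \<times> real \<Rightarrow> real) \<Rightarrow> (real \<times> real \<Rightarrow> real) \<Rightarrow> real" where
  "cSSIM c\<^sub>1 c\<^sub>2 N M f g =
    (2 * img_mean N M f * img_mean N M g + c\<^sub>1) /
      ((img_mean N M f)\<^sup>2 + (img_mean N M g)\<^sup>2 + c\<^sub>1) *
    ((2 * img_cov N M f g + c\<^sub>2) / (img_var N M f + img_var N M g + c\<^sub>2))"

definition cSSIM_const ::
  "real \<Rightarrow> real \<Rightarrow> nat \<Rightarrow> nat \<Rightarrow> (real \<times> real \<Rightarrow> real) \<Rightarrow> real" where
  "cSSIM_const c\<^sub>1 c\<^sub>2 N M f =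
    4 / (img_var N M f + c\<^sub>2) + 1 / ((img_mean N M f)\<^sup>2 + c\<^sub>1)"

end

theory Submission
  imports Defs "HOL-Probability.Probability_Measure"
begin

text \<open>
  The similarity index is a product of two quotients, each of the shape
  \<open>2pq / (p\<^sup>2 + q\<^sup>2)\<close> with a stabilising constant, so the defect of each factor from \<open>1\<close> has
  a quadratic numerator: \<open>(\<mu>\<^sub>f - \<mu>\<^sub>g)\<^sup>2\<close> for the means, the variance of \<open>f - g\<close> for the covariances. For measurable functions
  with values in \<open>[0, 255]\<close> both numerators are at most \<open>255\<close> times the mean of \<open>\<bar>f - g\<bar>\<close>, and the
  denominators are at least those occurring in the constant of the theorem. This gives
  \<open>one_minus_cSSIM_le\<close> and leaves the mean absolute error of the operator to be estimated.

  The convergence of the operator is in general not uniform near the pixel boundaries, where the image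
  may jump. But the kernel decays exponentially, so at a point at distance more than \<open>\<delta>\<close> from every interior
  boundary the nodes in other pixels carry only a share \<open>O(exp (- n\<delta>/2))\<close> of the total weight
  (\<open>nn_operator_local_error\<close>), whereas the remaining points have probability at most \<open>4\<delta>\<close>
  (\<open>prob_strips\<close>) and contribute an error of at most \<open>255\<close> each. The choice
  \<open>\<delta> = 2 ln n / n\<close> turns the first quantity into \<open>O(1/n)\<close> and the second into \<open>O(ln n / n)\<close>
  (\<open>digital_image_mean_error\<close>).

  The ramp and the logistic function enter only through monotonicity, a strict increase between
  \<open>0\<close> and \<open>1\<close>, and the bound \<open>exp 2 * exp (- \<bar>s\<bar>)\<close> on their kernels. The resulting constant
  depends on neither the image nor the stabilising constants.
\<close>

section \<open>Similarity defect and mean absolute error\<close>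

text \<open>
  With \<open>L\<close> and \<open>S\<close> the two factors, \<open>1 - L S = (1 - L) + L (1 - S)\<close>. Here \<open>1 - L\<close> is a quotient with
  numerator \<open>(a - b)\<^sup>2\<close>, \<open>1 - S\<close> one with numerator \<open>v + w - 2s\<close>, and \<open>0 \<le> L \<le> 1\<close>; dropping \<open>b\<^sup>2\<close> and
  \<open>w\<close> from the denominators only enlarges the quotients.
\<close>

lemma ssim_defect_bound:
  fixes a b v w s c d :: real
  assumes "0 \<le> a" "0 \<le> b" "0 \<le> v" "0 \<le> w" "2 * s \<le> v + w" "0 < c" "0 < d"
  shows "\<bar>1 - (2 * a * b + c) / (a\<^sup>2 + b\<^sup>2 + c) * ((2 * s + d) / (v + w + d))\<bar>
    \<le> (a - b)\<^sup>2 / (a\<^sup>2 + c) + (v + w - 2 * s) / (v + d)"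
proof -
  define L where "L = (2 * a * b + c) / (a\<^sup>2 + b\<^sup>2 + c)"
  define S where "S = (2 * s + d) / (v + w + d)"
  have pos: "0 < a\<^sup>2 + c" "0 < a\<^sup>2 + b\<^sup>2 + c"
    using assms by (auto intro: add_nonneg_pos)
  have L: "1 - L = (a - b)\<^sup>2 / (a\<^sup>2 + b\<^sup>2 + c)"
    unfolding L_def using pos by (simp add: field_simps power2_eq_square)
  have L_le: "1 - L \<le> (a - b)\<^sup>2 / (a\<^sup>2 + c)"
    unfolding L using pos by (intro divide_left_mono mult_pos_pos) auto
  have L0: "0 \<le> L"
    unfolding L_def using pos assms by (intro divide_nonneg_pos) auto
  have L1: "0 \<le> 1 - L"
    unfolding L using pos by simp
  have S: "1 - S = (v + w - 2 * s) / (v + w + d)"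
    unfolding S_def using assms by (simp add: field_simps)
  have S_le: "1 - S \<le> (v + w - 2 * s) / (v + d)"
    unfolding S using assms by (intro divide_left_mono mult_pos_pos) auto
  have S1: "0 \<le> 1 - S"
    unfolding S using assms by simp
  have "1 - L * S = (1 - L) + L * (1 - S)"
    by (simp add: algebra_simps)
  moreover have "0 \<le> L * (1 - S)" "L * (1 - S) \<le> 1 * (1 - S)"
    using L0 L1 S1 by (simp, intro mult_right_mono) auto
  ultimately have "0 \<le> 1 - L * S" "1 - L * S \<le> (1 - L) + (1 - S)"
    using L1 by auto
  then have "\<bar>1 - L * S\<bar> \<le> (a - b)\<^sup>2 / (a\<^sup>2 + c) + (v + w - 2 * s) / (v + d)"
    using add_mono[OF L_le S_le] by simp
  then show ?thesis
    by (simp add: L_def S_def)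
qed

text \<open>
  The combination of covariances is the variance of \<open>f - g\<close>, that is,
  \<open>E (f - g)\<^sup>2 - (a - b)\<^sup>2\<close>. Its non-negativity bounds \<open>(a - b)\<^sup>2\<close> by \<open>E (f - g)\<^sup>2\<close>, which is at most
  \<open>B E \<bar>f - g\<bar>\<close> because \<open>\<bar>f - g\<bar> \<le> B\<close>.
\<close>

lemma (in prob_space) covariance_defect_le:
  fixes f g :: "'a \<Rightarrow> real"
  assumes f: "f \<in> borel_measurable M" "\<And>x. x \<in> space M \<Longrightarrow> 0 \<le> f x \<and> f x \<le> B"
    and g: "g \<in> borel_measurable M" "\<And>x. x \<in> space M \<Longrightarrow> 0 \<le> g x \<and> g x \<le> B"
  defines "a \<equiv> expectation f" and "b \<equiv> expectation g"
  shows "(a - b)\<^sup>2 \<le> B * expectation (\<lambda>x. \<bar>f x - g x\<bar>)"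
    and "0 \<le> expectation (\<lambda>x. (f x - a) * (f x - a)) + expectation (\<lambda>x. (g x - b) * (g x - b))
           - 2 * expectation (\<lambda>x. (f x - a) * (g x - b))"
    and "expectation (\<lambda>x. (f x - a) * (f x - a)) + expectation (\<lambda>x. (g x - b) * (g x - b))
           - 2 * expectation (\<lambda>x. (f x - a) * (g x - b)) \<le> B * expectation (\<lambda>x. \<bar>f x - g x\<bar>)"
proof -
  note [measurable] = f(1) g(1)
  have bounded: "integrable M h"
    if "h \<in> borel_measurable M" "\<And>x. x \<in> space M \<Longrightarrow> \<bar>h x\<bar> \<le> K" for h :: "'a \<Rightarrow> real" and K
    using that by (intro integrable_const_bound[where B = K] AE_I2) auto
  have dev: "\<bar>f x - a\<bar> \<le> B + \<bar>a\<bar>" "\<bar>g x - b\<bar> \<le> B + \<bar>b\<bar>" "\<bar>f x - g x\<bar> \<le> B"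
    if "x \<in> space M" for x
    using f(2)[OF that] g(2)[OF that] by linarith+
  have prod_le: "\<bar>u * w\<bar> \<le> p * q" if "\<bar>u\<bar> \<le> p" "\<bar>w\<bar> \<le> q" for u w p q :: real
    unfolding abs_mult using that by (intro mult_mono) auto
  have int_f: "integrable M f" and int_g: "integrable M g"
    using bounded[of f B] bounded[of g B] f g by auto
  have int_ff: "integrable M (\<lambda>x. (f x - a) * (f x - a))"
    by (rule bounded[OF _ prod_le[OF dev(1) dev(1)]]) auto
  have int_gg: "integrable M (\<lambda>x. (g x - b) * (g x - b))"
    by (rule bounded[OF _ prod_le[OF dev(2) dev(2)]]) auto
  have int_fg: "integrable M (\<lambda>x. (f x - a) * (g x - b))"
    by (rule bounded[OF _ prod_le[OF dev(1) dev(2)]]) auto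
  have int_abs: "integrable M (\<lambda>x. \<bar>f x - g x\<bar>)"
    using int_f int_g by auto
  have sq_le: "(f x - g x)\<^sup>2 \<le> B * \<bar>f x - g x\<bar>" if "x \<in> space M" for x
    using mult_right_mono[OF dev(3)[OF that] abs_ge_zero[of "f x - g x"]]
    by (simp add: power2_eq_square)
  have int_sq: "integrable M (\<lambda>x. (f x - g x)\<^sup>2)"
    by (rule Bochner_Integration.integrable_bound[OF integrable_mult_right[OF int_abs, of B]])
       (auto intro!: AE_I2 sq_le order_trans[OF sq_le abs_ge_self] simp del: abs_mult)
  have sq: "expectation (\<lambda>x. (f x - g x)\<^sup>2) \<le> B * expectation (\<lambda>x. \<bar>f x - g x\<bar>)"
    using integral_mono[OF int_sq integrable_mult_right[OF int_abs, of B] sq_le] by simp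
  have var: "expectation (\<lambda>x. (f x - a) * (f x - a)) + expectation (\<lambda>x. (g x - b) * (g x - b))
           - 2 * expectation (\<lambda>x. (f x - a) * (g x - b))
      = expectation (\<lambda>x. ((f x - a) - (g x - b))\<^sup>2)"
  proof -
    have "expectation (\<lambda>x. ((f x - a) - (g x - b))\<^sup>2)
      = expectation (\<lambda>x. (f x - a) * (f x - a) + (g x - b) * (g x - b) - 2 * ((f x - a) * (g x - b)))"
      by (rule Bochner_Integration.integral_cong) (auto simp: power2_eq_square algebra_simps)
    then show ?thesis
      using int_ff int_gg int_fg by simp
  qed
  have var': "expectation (\<lambda>x. ((f x - a) - (g x - b))\<^sup>2) = expectation (\<lambda>x. (f x - g x)\<^sup>2) - (a - b)\<^sup>2"
  proof -
    have "expectation (\<lambda>x. ((f x - a) - (g x - b))\<^sup>2)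
      = expectation (\<lambda>x. (f x - g x)\<^sup>2 - 2 * (a - b) * (f x - g x) + (a - b)\<^sup>2)"
      by (rule Bochner_Integration.integral_cong) (auto simp: power2_eq_square algebra_simps)
    also have "\<dots> = expectation (\<lambda>x. (f x - g x)\<^sup>2) - 2 * (a - b) * (a - b) + (a - b)\<^sup>2"
      using int_sq int_f int_g by (simp add: a_def b_def prob_space)
    finally show ?thesis
      by (simp add: power2_eq_square)
  qed
  have nonneg: "0 \<le> expectation (\<lambda>x. ((f x - a) - (g x - b))\<^sup>2)"
    by simp
  show "(a - b)\<^sup>2 \<le> B * expectation (\<lambda>x. \<bar>f x - g x\<bar>)"
    using var' nonneg sq by linarith
  show "0 \<le> expectation (\<lambda>x. (f x - a) * (f x - a)) + expectation (\<lambda>x. (g x - b) * (g x - b))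
           - 2 * expectation (\<lambda>x. (f x - a) * (g x - b))"
    using var nonneg by linarith
  have "0 \<le> (a - b)\<^sup>2" by simp
  then show "expectation (\<lambda>x. (f x - a) * (f x - a)) + expectation (\<lambda>x. (g x - b) * (g x - b))
           - 2 * expectation (\<lambda>x. (f x - a) * (g x - b)) \<le> B * expectation (\<lambda>x. \<bar>f x - g x\<bar>)"
    using var var' sq by linarith
qed

lemma (in prob_space) expectation_abs_diff_le:
  fixes f g :: "'a \<Rightarrow> real"
  assumes [measurable]: "f \<in> borel_measurable M" "g \<in> borel_measurable M" "A \<in> events"
    and B: "\<And>x. x \<in> space M \<Longrightarrow> \<bar>f x - g x\<bar> \<le> B"
    and e: "\<And>x. x \<in> space M - A \<Longrightarrow> \<bar>f x - g x\<bar> \<le> e" and "0 \<le> e"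
  shows "expectation (\<lambda>x. \<bar>f x - g x\<bar>) \<le> B * prob A + e"
proof -
  have int_A: "integrable M (indicator A :: 'a \<Rightarrow> real)"
    by (intro integrable_real_indicator) (auto simp: emeasure_eq_measure)
  have "expectation (\<lambda>x. \<bar>f x - g x\<bar>) \<le> expectation (\<lambda>x. B * indicator A x + e)"
  proof (rule integral_mono)
    show "integrable M (\<lambda>x. \<bar>f x - g x\<bar>)"
      using B by (intro integrable_const_bound[where B = B] AE_I2) auto
    show "\<bar>f x - g x\<bar> \<le> B * indicator A x + e" if "x \<in> space M" for x
      using B[OF that] e[of x] \<open>0 \<le> e\<close> that by (cases "x \<in> A") auto
  qed (use int_A in simp)
  also have "\<dots> = B * prob A + e"
    using int_A by (simp add: prob_space)
  finally show ?thesis .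
qed

section \<open>The normalized rectangle\<close>

lemma space_image_measure [simp]: "space (image_measure N M) = image_domain N M"
  by (simp add: image_measure_def space_restrict_space)

lemma image_domain_cbox: "image_domain N M = cbox (0, 0) (real N, real M)"
  by (simp add: image_domain_def cbox_Pair_eq)

lemma sets_lebesgue_image_domain: "image_domain N M \<in> sets lebesgue"
  by (simp add: image_domain_cbox)

lemma borel_imp_image_measure:
  assumes "h \<in> borel_measurable borel"
  shows "h \<in> borel_measurable (image_measure N M)"
proof -
  have "h \<in> borel_measurable (lebesgue_on (image_domain N M))"
    using assms by (intro measurable_restrict_space1 measurable_completion) simp
  then show ?thesis
    by (simp add: image_measure_def cong: measurable_cong_sets)
qed

lemma emeasure_image_domain:
  "emeasure (lebesgue_on (image_domain N M)) (image_domain N M) = ennreal (real N * real M)"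
proof -
  have "emeasure (lebesgue_on (image_domain N M)) (image_domain N M) = emeasure lborel (image_domain N M)"
    by (simp add: emeasure_restrict_space image_domain_cbox)
  also have "\<dots> = ennreal (real N * real M)"
    unfolding image_domain_cbox
    by (subst emeasure_lborel_cbox) (auto simp: Basis_prod_def prod.union_disjoint)
  finally show ?thesis .
qed

lemma prob_space_image_measure:
  assumes "0 < N" "0 < M"
  shows "prob_space (image_measure N M)"
  unfolding image_measure_def
  by (rule prob_space_uniform_measure)
     (use assms in \<open>simp_all add: emeasure_image_domain ennreal_eq_0_iff mult_le_0_iff\<close>)

text \<open>
  The summands of the constant are, up to the factor \<open>4\<close>, the reciprocals of the denominators in
  \<open>ssim_defect_bound\<close>; by \<open>covariance_defect_le\<close> both numerators there are at most \<open>B E \<bar>f - g\<bar>\<close>.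
\<close>

lemma one_minus_cSSIM_le:
  assumes "0 < N" "0 < M" "0 < c\<^sub>1" "0 < c\<^sub>2"
    and f: "f \<in> borel_measurable (image_measure N M)" "\<And>x. x \<in> image_domain N M \<Longrightarrow> f x \<in> {0..B}"
    and g: "g \<in> borel_measurable (image_measure N M)" "\<And>x. x \<in> image_domain N M \<Longrightarrow> g x \<in> {0..B}"
  shows "\<bar>1 - cSSIM c\<^sub>1 c\<^sub>2 N M f g\<bar>
    \<le> cSSIM_const c\<^sub>1 c\<^sub>2 N M f * (B * (LINT x|image_measure N M. \<bar>f x - g x\<bar>))"
proof -
  interpret prob_space "image_measure N M"
    using assms by (simp add: prob_space_image_measure)
  let ?D = "B * (LINT x|image_measure N M. \<bar>f x - g x\<bar>)"
  let ?a = "img_mean N M f" and ?b = "img_mean N M g"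
  let ?v = "img_var N M f" and ?w = "img_var N M g" and ?s = "img_cov N M f g"
  have range: "0 \<le> f x \<and> f x \<le> B" "0 \<le> g x \<and> g x \<le> B" if "x \<in> space (image_measure N M)" for x
    using f(2) g(2) that by auto
  have mean_defect: "(?a - ?b)\<^sup>2 \<le> ?D"
    unfolding img_mean_def using f(1) g(1) range by (intro covariance_defect_le(1)) auto
  have cov_defect: "0 \<le> ?v + ?w - 2 * ?s" "?v + ?w - 2 * ?s \<le> ?D"
    unfolding img_var_def img_cov_def img_mean_def
    using f(1) g(1) range by (intro covariance_defect_le(2,3)[where B = B]; auto)+
  have means: "0 \<le> ?a" "0 \<le> ?b"
    unfolding img_mean_def by (intro integral_nonneg_AE AE_I2; use range in force)+
  have vars: "0 \<le> ?v" "0 \<le> ?w"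
    unfolding img_var_def img_cov_def by (intro integral_nonneg_AE AE_I2; simp)+
  have D: "0 \<le> ?D"
    using cov_defect by linarith
  have pos: "0 < ?a\<^sup>2 + c\<^sub>1" "0 < ?v + c\<^sub>2"
    using assms vars by (auto intro: add_nonneg_pos)
  have "\<bar>1 - cSSIM c\<^sub>1 c\<^sub>2 N M f g\<bar> \<le> (?a - ?b)\<^sup>2 / (?a\<^sup>2 + c\<^sub>1) + (?v + ?w - 2 * ?s) / (?v + c\<^sub>2)"
    unfolding cSSIM_def using assms means vars cov_defect(1) by (intro ssim_defect_bound) auto
  also have "\<dots> \<le> ?D / (?a\<^sup>2 + c\<^sub>1) + ?D / (?v + c\<^sub>2)"
    using pos mean_defect cov_defect by (intro add_mono divide_right_mono) auto
  also have "\<dots> \<le> ?D / (?a\<^sup>2 + c\<^sub>1) + 4 * ?D / (?v + c\<^sub>2)"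
    using pos D by (intro add_mono divide_right_mono) auto
  also have "\<dots> = cSSIM_const c\<^sub>1 c\<^sub>2 N M f * ?D"
    by (simp add: cSSIM_const_def algebra_simps)
  finally show ?thesis .
qed

lemma borel_box_sets_image_measure:
  "image_domain N M \<inter> cbox p q \<in> sets (image_measure N M)"
  by (simp add: image_measure_def sets_restrict_space_iff image_domain_cbox)

lemma measure_image_measure_cbox_Int:
  assumes "0 < N" "0 < M"
  shows "measure (image_measure N M) (image_domain N M \<inter> cbox (a, b) (c, d))
    = measure lborel (image_domain N M \<inter> cbox (a, b) (c, d)) / (real N * real M)"
proof -
  let ?Q = "image_domain N M" and ?S = "image_domain N M \<inter> cbox (a, b) (c, d)"
  have S: "?S \<in> sets borel"
    by (simp add: image_domain_cbox)
  have Q: "measure (lebesgue_on ?Q) ?Q = real N * real M"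
    using emeasure_image_domain[of N M] by (simp add: measure_def)
  have "measure (image_measure N M) ?S = measure (lebesgue_on ?Q) (?Q \<inter> ?S) / measure (lebesgue_on ?Q) ?Q"
    unfolding image_measure_def
    by (rule measure_uniform_measure)
       (use assms S in \<open>simp_all add: emeasure_image_domain ennreal_eq_0_iff mult_le_0_iff
          sets_restrict_space_iff sets_lebesgue_image_domain\<close>)
  also have "measure (lebesgue_on ?Q) (?Q \<inter> ?S) = measure lborel ?S"
    using S by (simp add: measure_restrict_space image_domain_cbox Int_absorb1)
  finally show ?thesis
    by (simp add: Q)
qed

text \<open>
  The index stops short of \<open>0\<close> and \<open>N\<close>: an image jumps only at the boundaries between two pixels.
\<close>

definition strip :: "nat \<Rightarrow> real \<Rightarrow> real set" where
  "strip N \<delta> = (\<Union>m\<in>{1..<N}. {real m - \<delta>..real m + \<delta>})"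

text \<open>
  A slab of width \<open>2\<delta>\<close> across the rectangle has area at most \<open>2\<delta>\<close> times its length, and normalisation
  cancels the length. The intersection cuts off slabs that reach over the edge of the rectangle.
\<close>

lemma measure_slab_le:
  assumes "0 < N" "0 < M" "0 \<le> \<delta>"
  shows "measure (image_measure N M) (image_domain N M \<inter> cbox (t - \<delta>, 0) (t + \<delta>, real M)) \<le> 2 * \<delta> / real N"
    and "measure (image_measure N M) (image_domain N M \<inter> cbox (0, t - \<delta>) (real N, t + \<delta>)) \<le> 2 * \<delta> / real M"
proof -
  have le: "measure lborel (image_domain N M \<inter> cbox p q) \<le> measure lborel (cbox p q)" for p q
    by (intro measure_mono_fmeasurable) (auto simp: image_domain_cbox)
  have "measure lborel (image_domain N M \<inter> cbox (t - \<delta>, 0) (t + \<delta>, real M)) \<le> 2 * \<delta> * real M"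
    using le[of "(t - \<delta>, 0)" "(t + \<delta>, real M)"] assms by (simp add: content_Pair)
  then show "measure (image_measure N M) (image_domain N M \<inter> cbox (t - \<delta>, 0) (t + \<delta>, real M)) \<le> 2 * \<delta> / real N"
    using assms by (simp add: measure_image_measure_cbox_Int field_simps)
  have "measure lborel (image_domain N M \<inter> cbox (0, t - \<delta>) (real N, t + \<delta>)) \<le> 2 * \<delta> * real N"
    using le[of "(0, t - \<delta>)" "(real N, t + \<delta>)"] assms by (simp add: content_Pair mult.commute)
  then show "measure (image_measure N M) (image_domain N M \<inter> cbox (0, t - \<delta>) (real N, t + \<delta>)) \<le> 2 * \<delta> / real M"
    using assms by (simp add: measure_image_measure_cbox_Int field_simps)
qed

lemma strips_eq:
  "{x \<in> image_domain N M. fst x \<in> strip N \<delta> \<or> snd x \<in> strip M \<delta>}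
    = (\<Union>m\<in>{1..<N}. image_domain N M \<inter> cbox (real m - \<delta>, 0) (real m + \<delta>, real M)) \<union>
      (\<Union>m\<in>{1..<M}. image_domain N M \<inter> cbox (0, real m - \<delta>) (real N, real m + \<delta>))"
  by (auto simp: strip_def image_domain_def cbox_Pair_eq)

text \<open>
  There are \<open>N - 1\<close> slabs of probability at most \<open>2\<delta>/N\<close> in one direction and \<open>M - 1\<close> of probability
  at most \<open>2\<delta>/M\<close> in the other, so the bound is free of \<open>N\<close> and \<open>M\<close>.
\<close>

lemma prob_strips:
  assumes "0 < N" "0 < M" "0 \<le> \<delta>"
  defines "A \<equiv> {x \<in> image_domain N M. fst x \<in> strip N \<delta> \<or> snd x \<in> strip M \<delta>}"
  shows "A \<in> sets (image_measure N M)" and "measure (image_measure N M) A \<le> 4 * \<delta>"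
proof -
  interpret prob_space "image_measure N M"
    using assms by (simp add: prob_space_image_measure)
  note [simp] = borel_box_sets_image_measure
  let ?V = "\<lambda>m::nat. image_domain N M \<inter> cbox (real m - \<delta>, 0) (real m + \<delta>, real M)"
  let ?H = "\<lambda>m::nat. image_domain N M \<inter> cbox (0, real m - \<delta>) (real N, real m + \<delta>)"
  show "A \<in> events"
    unfolding A_def strips_eq by (intro sets.Un sets.finite_UN) auto
  have half: "real (k - 1) * (2 * \<delta> / real k) \<le> 2 * \<delta>" if "0 < k" for k
    using that assms mult_right_mono[of "real (k - 1)" "real k" "2 * \<delta>"] by (simp add: field_simps)
  have "prob A \<le> prob (\<Union>m\<in>{1..<N}. ?V m) + prob (\<Union>m\<in>{1..<M}. ?H m)"
    unfolding A_def strips_eq by (intro measure_Un_le sets.finite_UN) auto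
  also have "prob (\<Union>m\<in>{1..<N}. ?V m) \<le> (\<Sum>m\<in>{1..<N}. prob (?V m))"
    by (intro finite_measure_subadditive_finite) auto
  also have "\<dots> \<le> (\<Sum>m\<in>{1..<N}. 2 * \<delta> / real N)"
    using assms by (intro sum_mono measure_slab_le)
  also have "\<dots> \<le> 2 * \<delta>"
    using half[of N] assms by simp
  also have "prob (\<Union>m\<in>{1..<M}. ?H m) \<le> (\<Sum>m\<in>{1..<M}. prob (?H m))"
    by (intro finite_measure_subadditive_finite) auto
  also have "\<dots> \<le> (\<Sum>m\<in>{1..<M}. 2 * \<delta> / real M)"
    using assms by (intro sum_mono measure_slab_le)
  also have "\<dots> \<le> 2 * \<delta>"
    using half[of M] assms by simp
  finally show "prob A \<le> 4 * \<delta>"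
    by simp
qed

section \<open>Digital images\<close>

text \<open>
  A point more than \<open>\<delta>\<close> away from an integer lies on the same side of it as every point less than
  \<open>\<delta>\<close> away from the first, and the sides of a pixel are determined by such comparisons with interior
  integers.
\<close>

lemma pixel_side_cong:
  assumes "t \<in> {0..real N}" "u \<in> {0..real N}" "t \<notin> strip N \<delta>" "\<bar>t - u\<bar> < \<delta>" "i \<in> {1..N}"
  shows "t \<in> pixel_side N i \<longleftrightarrow> u \<in> pixel_side N i"
proof -
  have same_side: "t < real m \<longleftrightarrow> u < real m" if "m \<in> {1..<N}" for m
  proof -
    have "\<not> (real m - \<delta> \<le> t \<and> t \<le> real m + \<delta>)"
      using assms(3) that by (auto simp: strip_def)
    then show ?thesis
      using assms(4) by linarith
  qed
  have lower: "real i - 1 \<le> t \<longleftrightarrow> real i - 1 \<le> u"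
  proof (cases "i = 1")
    case False
    then show ?thesis
      using same_side[of "i - 1"] assms(5) by (auto simp: not_less[symmetric] of_nat_diff)
  qed (use assms in auto)
  have upper: "t < real i \<longleftrightarrow> u < real i" if "i \<noteq> N"
    using same_side[of i] that assms(5) by auto
  show ?thesis
    using lower upper assms by (auto simp: pixel_side_def)
qed

lemma ex1_pixel_side:
  assumes "t \<in> {0..real N}" "0 < N"
  shows "\<exists>!i. i \<in> {1..N} \<and> t \<in> pixel_side N i"
proof (rule ex_ex1I)
  show "\<exists>i. i \<in> {1..N} \<and> t \<in> pixel_side N i"
  proof (cases "t = real N")
    case True
    then show ?thesis
      using assms by (intro exI[of _ N]) (auto simp: pixel_side_def)
  next
    case False
    define m where "m = nat \<lfloor>t\<rfloor>"
    have "real m = real_of_int \<lfloor>t\<rfloor>"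
      using assms by (simp add: m_def)
    then have m: "real m \<le> t" "t < real m + 1"
      by linarith+
    have "t < real N"
      using False assms by auto
    then have "m < N"
      using m(1) by linarith
    then have "Suc m \<in> {1..N}"
      by simp
    moreover have "t \<in> pixel_side N (Suc m)"
      using m by (auto simp: pixel_side_def)
    ultimately show ?thesis
      by blast
  qed
next
  have no_later: False
    if "i \<in> {1..N}" "j \<in> {1..N}" "t \<in> pixel_side N i" "t \<in> pixel_side N j" "i < j" for i j
  proof -
    have "t < real i" "real j - 1 \<le> t"
      using that by (auto simp: pixel_side_def split: if_splits)
    moreover have "real i \<le> real j - 1"
      using \<open>i < j\<close> by linarith
    ultimately show False by linarith
  qed
  show "i = j" if "i \<in> {1..N} \<and> t \<in> pixel_side N i" "j \<in> {1..N} \<and> t \<in> pixel_side N j" for i j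
    using no_later[of i j] no_later[of j i] that by (metis linorder_neqE_nat)
qed

lemma digital_image_range:
  assumes "digital_image N M f" "0 < N" "0 < M" "x \<in> image_domain N M"
  shows "f x \<in> {0..255}"
proof -
  obtain F :: "nat \<Rightarrow> nat \<Rightarrow> nat" where
    F: "\<And>i j. i \<in> {1..N} \<Longrightarrow> j \<in> {1..M} \<Longrightarrow> F i j \<in> {0..255}"
    and f: "f x = (\<Sum>i=1..N. \<Sum>j=1..M. real (F i j) * indicator (pixel N M i j) x)"
    using assms unfolding digital_image_def by blast
  have x: "fst x \<in> {0..real N}" "snd x \<in> {0..real M}"
    using assms(4) by (auto simp: image_domain_def)
  obtain p where p: "p \<in> {1..N}" "\<And>i. i \<in> {1..N} \<Longrightarrow> fst x \<in> pixel_side N i \<longleftrightarrow> i = p"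
    using ex1_pixel_side[OF x(1)] assms by metis
  obtain q where q: "q \<in> {1..M}" "\<And>j. j \<in> {1..M} \<Longrightarrow> snd x \<in> pixel_side M j \<longleftrightarrow> j = q"
    using ex1_pixel_side[OF x(2)] assms by metis
  have "f x = (\<Sum>i=1..N. \<Sum>j=1..M. if j = q then (if i = p then real (F i j) else 0) else 0)"
    unfolding f using p q
    by (intro sum.cong refl) (auto simp: pixel_def indicator_def mem_Times_iff)
  also have "\<dots> = real (F p q)"
    using p(1) q(1) by (simp add: sum.delta)
  finally show ?thesis
    using F[OF p(1) q(1)] by auto
qed

lemma digital_image_locally_constant:
  assumes "digital_image N M f" "x \<in> image_domain N M" "y \<in> image_domain N M"
    and "fst x \<notin> strip N \<delta>" "snd x \<notin> strip M \<delta>"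
    and "\<bar>fst x - fst y\<bar> < \<delta>" "\<bar>snd x - snd y\<bar> < \<delta>"
  shows "f x = f y"
proof -
  obtain F :: "nat \<Rightarrow> nat \<Rightarrow> nat" where
    f: "\<And>x. x \<in> image_domain N M \<Longrightarrow>
      f x = (\<Sum>i=1..N. \<Sum>j=1..M. real (F i j) * indicator (pixel N M i j) x)"
    using assms unfolding digital_image_def by blast
  have "x \<in> pixel N M i j \<longleftrightarrow> y \<in> pixel N M i j" if "i \<in> {1..N}" "j \<in> {1..M}" for i j
    using pixel_side_cong[of "fst x" N "fst y" \<delta> i] pixel_side_cong[of "snd x" M "snd y" \<delta> j] assms that
    by (simp add: pixel_def image_domain_def mem_Times_iff)
  then show ?thesis
    unfolding f[OF assms(2)] f[OF assms(3)]
    by (intro sum.cong refl) (simp add: indicator_def)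
qed

lemma digital_image_measurable:
  assumes "digital_image N M f"
  shows "f \<in> borel_measurable (image_measure N M)"
proof -
  obtain F :: "nat \<Rightarrow> nat \<Rightarrow> nat" where
    f: "\<And>x. x \<in> image_domain N M \<Longrightarrow>
      f x = (\<Sum>i=1..N. \<Sum>j=1..M. real (F i j) * indicator (pixel N M i j) x)"
    using assms unfolding digital_image_def by blast
  have [measurable]: "pixel N M i j \<in> sets borel" for i j
    by (auto simp: pixel_def pixel_side_def borel_prod[symmetric] intro!: pair_measureI)
  have "(\<lambda>x. \<Sum>i=1..N. \<Sum>j=1..M. real (F i j) * indicator (pixel N M i j) x) \<in> borel_measurable borel"
    by measurable
  from borel_imp_image_measure[OF this] show ?thesis
    by (rule measurable_cong[THEN iffD2, rotated]) (simp add: f)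
qed

section \<open>Localization of the operators\<close>

text \<open>
  A geometric series dominates any finite sum of powers with distinct exponents, which gives bounds
  that are uniform in the size of the node set.
\<close>

lemma sum_inj_power_le:
  fixes r :: real and j :: "'a \<Rightarrow> nat"
  assumes "finite A" "inj_on j A" "0 \<le> r" "r < 1"
  shows "(\<Sum>k\<in>A. r ^ j k) \<le> 1 / (1 - r)"
proof -
  have "(\<Sum>k\<in>A. r ^ j k) = (\<Sum>i\<in>j ` A. r ^ i)"
    using assms by (simp add: sum.reindex)
  also have "\<dots> \<le> (\<Sum>i. r ^ i)"
    using assms by (intro sum_le_suminf summable_geometric) auto
  finally show ?thesis
    using assms by (simp add: suminf_geometric)
qed

text \<open>
  To the left and to the right of \<open>u\<close> the distances to the integers grow at least like \<open>0, 1, 2, \<dots>\<close>,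
  so each side is dominated by a geometric series of ratio \<open>exp (- (1/2))\<close>.
\<close>

lemma sum_exp_dist_int_le:
  fixes A :: "int set" and u :: real
  assumes "finite A"
  shows "(\<Sum>k\<in>A. exp (- (\<bar>u - of_int k\<bar> / 2))) \<le> 2 / (1 - exp (- (1 / 2)))"
proof -
  define r :: real where "r = exp (- (1 / 2))"
  have r: "0 \<le> r" "r < 1"
    by (auto simp: r_def)
  have power: "r ^ j = exp (- (real j / 2))" for j
    by (simp add: r_def exp_of_nat_mult[symmetric])
  let ?L = "{k \<in> A. k \<le> \<lfloor>u\<rfloor>}" and ?R = "{k \<in> A. \<not> k \<le> \<lfloor>u\<rfloor>}"
  let ?e = "\<lambda>k::int. exp (- (\<bar>u - of_int k\<bar> / 2))"
  have left: "real (nat (\<lfloor>u\<rfloor> - k)) \<le> \<bar>u - of_int k\<bar>" if "k \<le> \<lfloor>u\<rfloor>" for k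
    using that of_int_floor_le[of u] by simp linarith
  have right: "real (nat (k - \<lfloor>u\<rfloor> - 1)) \<le> \<bar>u - of_int k\<bar>" if "\<not> k \<le> \<lfloor>u\<rfloor>" for k
    using that floor_correct[of u] by simp linarith
  have "sum ?e ?L \<le> (\<Sum>k\<in>?L. r ^ nat (\<lfloor>u\<rfloor> - k))"
    unfolding power
    by (intro sum_mono iffD2[OF exp_le_cancel_iff] le_imp_neg_le divide_right_mono left) auto
  also have "\<dots> \<le> 1 / (1 - r)"
    using assms r by (intro sum_inj_power_le) (auto simp: inj_on_def)
  finally have L: "sum ?e ?L \<le> 1 / (1 - r)" .
  have "sum ?e ?R \<le> (\<Sum>k\<in>?R. r ^ nat (k - \<lfloor>u\<rfloor> - 1))"
    unfolding power
    by (intro sum_mono iffD2[OF exp_le_cancel_iff] le_imp_neg_le divide_right_mono right) auto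
  also have "\<dots> \<le> 1 / (1 - r)"
    using assms r by (intro sum_inj_power_le) (auto simp: inj_on_def)
  finally have R: "sum ?e ?R \<le> 1 / (1 - r)" .
  have "sum ?e A = sum ?e ?L + sum ?e ?R"
    using assms by (subst sum.union_disjoint[symmetric]) (auto intro!: sum.cong)
  then show ?thesis
    using L R by (simp add: r_def)
qed

text \<open>
  Monotonicity makes the kernel non-negative, the strict increase between \<open>0\<close> and \<open>1\<close> keeps the
  denominator of the operator away from zero, and the decay localizes the operator.
\<close>

locale decaying_sigmoid =
  fixes \<sigma> :: "real \<Rightarrow> real" and C :: real
  assumes mono_sigmoid: "mono \<sigma>"
    and sigmoid_step: "\<sigma> 0 < \<sigma> 1"
    and phi_decay: "phi \<sigma> s \<le> C * exp (- \<bar>s\<bar>)"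
begin

definition phi_floor :: real where
  "phi_floor = (\<sigma> 1 - \<sigma> 0) / 2"

lemma phi_floor_pos: "0 < phi_floor"
  using sigmoid_step by (simp add: phi_floor_def)

lemma phi_nonneg: "0 \<le> phi \<sigma> s"
  using monoD[OF mono_sigmoid, of "s - 1" "s + 1"] by (simp add: phi_def)

lemma decay_const_nonneg: "0 \<le> C"
  using phi_nonneg[of 0] phi_decay[of 0] by simp

lemma phi_ge_floor:
  assumes "0 \<le> s" "s \<le> 1"
  shows "phi_floor \<le> phi \<sigma> s"
  using monoD[OF mono_sigmoid, of 1 "s + 1"] monoD[OF mono_sigmoid, of "s - 1" 0] assms
  by (simp add: phi_def phi_floor_def)

abbreviation weight :: "nat \<Rightarrow> real \<times> real \<Rightarrow> int \<times> int \<Rightarrow> real" where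
  "weight n x k \<equiv> Psi \<sigma> (real n * fst x - of_int (fst k), real n * snd x - of_int (snd k))"

lemma weight_nonneg: "0 \<le> weight n x k"
  by (simp add: Psi_def phi_nonneg)

lemma finite_node_set [simp]: "finite (node_set N M n)"
  by (simp add: node_set_def)

text \<open>
  The node obtained by rounding down both coordinates of \<open>n x\<close> lies in the node set and alone
  contributes this much, since its offset from \<open>n x\<close> is in the unit square.
\<close>

lemma weight_sum_ge:
  assumes "x \<in> image_domain N M"
  shows "phi_floor\<^sup>2 \<le> (\<Sum>k\<in>node_set N M n. weight n x k)"
proof -
  let ?u = "real n * fst x" and ?v = "real n * snd x"
  let ?k = "(\<lfloor>?u\<rfloor>, \<lfloor>?v\<rfloor>)"
  have x: "0 \<le> fst x" "fst x \<le> real N" "0 \<le> snd x" "snd x \<le> real M"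
    using assms by (auto simp: image_domain_def)
  have "?u \<le> real (n * N)" "?v \<le> real (n * M)"
    using x by (auto intro: mult_left_mono)
  then have "\<lfloor>?u\<rfloor> \<le> int (n * N)" "\<lfloor>?v\<rfloor> \<le> int (n * M)"
    by (metis floor_mono floor_of_nat)+
  then have k: "?k \<in> node_set N M n"
    using x by (auto simp: node_set_def)
  have "phi_floor \<le> phi \<sigma> (?u - of_int \<lfloor>?u\<rfloor>)" "phi_floor \<le> phi \<sigma> (?v - of_int \<lfloor>?v\<rfloor>)"
    by (intro phi_ge_floor; linarith)+
  then have "phi_floor\<^sup>2 \<le> weight n x ?k"
    using phi_floor_pos by (auto simp: Psi_def power2_eq_square intro!: mult_mono phi_nonneg)
  also have "\<dots> \<le> (\<Sum>k\<in>node_set N M n. weight n x k)"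
    by (rule member_le_sum[OF k]) (auto simp: weight_nonneg)
  finally show ?thesis .
qed

lemma weight_sum_pos:
  assumes "x \<in> image_domain N M"
  shows "0 < (\<Sum>k\<in>node_set N M n. weight n x k)"
  using weight_sum_ge[OF assms, of n] phi_floor_pos by (meson less_le_trans zero_less_power)

lemma nn_operator_eq:
  "nn_operator \<sigma> N M n f x =
    (\<Sum>k\<in>node_set N M n. f (of_int (fst k) / real n, of_int (snd k) / real n) * weight n x k) /
    (\<Sum>k\<in>node_set N M n. weight n x k)"
  by (simp add: nn_operator_def split_beta)

lemma node_in_image_domain:
  assumes "k \<in> node_set N M n" "0 < n"
  shows "(of_int (fst k) / real n, of_int (snd k) / real n) \<in> image_domain N M"
proof -
  have "real_of_int (fst k) \<le> real n * real N" "real_of_int (snd k) \<le> real n * real M"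
    using assms(1) of_int_le_iff[of "fst k" "int (n * N)", where ?'a = real]
      of_int_le_iff[of "snd k" "int (n * M)", where ?'a = real] by (auto simp: node_set_def)
  then show ?thesis
    using assms by (auto simp: node_set_def image_domain_def divide_simps mult.commute)
qed

text \<open>
  The operator takes weighted averages of node values.
\<close>

lemma nn_operator_range:
  assumes "\<And>y. y \<in> image_domain N M \<Longrightarrow> f y \<in> {a..b}" "x \<in> image_domain N M" "0 < n"
  shows "nn_operator \<sigma> N M n f x \<in> {a..b}"
proof -
  let ?W = "\<Sum>k\<in>node_set N M n. weight n x k"
  let ?f = "\<lambda>k. f (of_int (fst k) / real n, of_int (snd k) / real n)"
  have f: "a \<le> ?f k" "?f k \<le> b" if "k \<in> node_set N M n" for k
    using assms(1)[OF node_in_image_domain[OF that assms(3)]] by auto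
  have "a * ?W \<le> (\<Sum>k\<in>node_set N M n. ?f k * weight n x k)"
    unfolding sum_distrib_left by (intro sum_mono mult_right_mono f weight_nonneg)
  moreover have "(\<Sum>k\<in>node_set N M n. ?f k * weight n x k) \<le> b * ?W"
    unfolding sum_distrib_left by (intro sum_mono mult_right_mono f weight_nonneg)
  ultimately show ?thesis
    using weight_sum_pos[OF assms(2), of n] by (simp add: nn_operator_eq field_simps)
qed

lemma nn_operator_measurable:
  "nn_operator \<sigma> N M n f \<in> borel_measurable borel"
proof -
  have [measurable]: "\<sigma> \<in> borel_measurable borel"
    using mono_sigmoid by (rule borel_measurable_mono)
  have [measurable]: "(\<lambda>x. weight n x k) \<in> borel_measurable borel" for k
    unfolding Psi_def phi_def by (simp add: borel_prod[symmetric])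
  show ?thesis
    unfolding nn_operator_eq by measurable
qed

text \<open>
  Per coordinate, this is the decay constant times the bound of \<open>sum_exp_dist_int_le\<close>, divided by the
  lower bound of the kernel that controls the denominator.
\<close>

definition localization_const :: real where
  "localization_const = (C * (2 / (1 - exp (- (1 / 2)))) / phi_floor)\<^sup>2"

lemma localization_const_nonneg: "0 \<le> localization_const"
  by (simp add: localization_const_def)

lemma phi_split: "phi \<sigma> s \<le> C * exp (- (\<bar>s\<bar> / 2))"
proof -
  have "C * exp (- \<bar>s\<bar>) \<le> C * exp (- (\<bar>s\<bar> / 2))"
    using decay_const_nonneg by (intro mult_left_mono) auto
  then show ?thesis
    using phi_decay[of s] by linarith
qed

text \<open>
  One half of the exponent pays for the distance \<open>d\<close>, the other half keeps the sum over all nodes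
  bounded.
\<close>

lemma phi_far:
  assumes "d \<le> \<bar>s\<bar>"
  shows "phi \<sigma> s \<le> C * exp (- (d / 2)) * exp (- (\<bar>s\<bar> / 2))"
proof -
  have "C * exp (- \<bar>s\<bar>) \<le> C * (exp (- (d / 2)) * exp (- (\<bar>s\<bar> / 2)))"
    using decay_const_nonneg assms
    by (intro mult_left_mono) (auto simp: mult_exp_exp)
  then show ?thesis
    using phi_decay[of s] by (simp add: mult.assoc)
qed

text \<open>
  A node within \<open>\<delta>\<close> of \<open>x\<close> in both coordinates contributes no error. For any other node one of the two
  kernel factors supplies \<open>exp (- n\<delta>/2)\<close>, and what remains is a product of two one-dimensional sums
  of the kind bounded by \<open>sum_exp_dist_int_le\<close>.
\<close>

lemma nn_operator_local_error:
  assumes x: "x \<in> image_domain N M" and "0 < n" "0 \<le> B"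
    and bound: "\<And>y. y \<in> image_domain N M \<Longrightarrow> \<bar>f x - f y\<bar> \<le> B"
    and const: "\<And>y. \<lbrakk>y \<in> image_domain N M; \<bar>fst x - fst y\<bar> < \<delta>; \<bar>snd x - snd y\<bar> < \<delta>\<rbrakk> \<Longrightarrow> f x = f y"
  shows "\<bar>f x - nn_operator \<sigma> N M n f x\<bar> \<le> B * localization_const * exp (- (real n * \<delta> / 2))"
proof -
  let ?W = "\<Sum>k\<in>node_set N M n. weight n x k"
  let ?p = "\<lambda>k::int \<times> int. (of_int (fst k) / real n, of_int (snd k) / real n) :: real \<times> real"
  define E where "E = exp (- (real n * \<delta> / 2))"
  define S where "S = 2 / (1 - exp (- (1 / 2) :: real))"
  let ?a = "\<lambda>k::int. exp (- (\<bar>real n * fst x - of_int k\<bar> / 2))"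
  let ?b = "\<lambda>k::int. exp (- (\<bar>real n * snd x - of_int k\<bar> / 2))"
  have E: "0 \<le> E" by (simp add: E_def)
  have S: "0 \<le> S" by (simp add: S_def)
  have W: "0 < ?W" "phi_floor\<^sup>2 \<le> ?W"
    using weight_sum_pos[OF x] weight_sum_ge[OF x] by auto
  have scale: "real n * \<delta> \<le> \<bar>real n * t - of_int k\<bar>" if "\<not> \<bar>t - of_int k / real n\<bar> < \<delta>" for t k
  proof -
    have "real n * \<delta> \<le> real n * \<bar>t - of_int k / real n\<bar>"
      using that by (intro mult_left_mono) auto
    also have "\<dots> = \<bar>real n * t - of_int k\<bar>"
      using \<open>0 < n\<close> by (simp add: abs_mult_pos' right_diff_distrib)
    finally show ?thesis .
  qed
  have term_le: "\<bar>f x - f (?p k)\<bar> * weight n x k \<le> B * C\<^sup>2 * E * (?a (fst k) * ?b (snd k))"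
    if k: "k \<in> node_set N M n" for k
  proof (cases "\<bar>fst x - fst (?p k)\<bar> < \<delta> \<and> \<bar>snd x - snd (?p k)\<bar> < \<delta>")
    case True
    then have "f x = f (?p k)"
      using const[OF node_in_image_domain[OF k \<open>0 < n\<close>]] by blast
    then show ?thesis
      using \<open>0 \<le> B\<close> E by simp
  next
    case False
    have "weight n x k \<le> C\<^sup>2 * E * (?a (fst k) * ?b (snd k))"
    proof (cases "\<bar>fst x - fst (?p k)\<bar> < \<delta>")
      case True
      with False have "real n * \<delta> \<le> \<bar>real n * snd x - of_int (snd k)\<bar>"
        by (intro scale) auto
      then have "weight n x k \<le> (C * ?a (fst k)) * (C * E * ?b (snd k))"
        unfolding Psi_def E_def fst_conv snd_conv
        using decay_const_nonneg by (intro mult_mono phi_split phi_far phi_nonneg) auto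
      then show ?thesis
        by (simp add: power2_eq_square mult_ac)
    next
      case False
      then have "real n * \<delta> \<le> \<bar>real n * fst x - of_int (fst k)\<bar>"
        by (intro scale) auto
      then have "weight n x k \<le> (C * E * ?a (fst k)) * (C * ?b (snd k))"
        unfolding Psi_def E_def fst_conv snd_conv
        using decay_const_nonneg by (intro mult_mono phi_split phi_far phi_nonneg) auto
      then show ?thesis
        by (simp add: power2_eq_square mult_ac)
    qed
    then have "\<bar>f x - f (?p k)\<bar> * weight n x k \<le> B * (C\<^sup>2 * E * (?a (fst k) * ?b (snd k)))"
      using \<open>0 \<le> B\<close> bound[OF node_in_image_domain[OF k \<open>0 < n\<close>]]
      by (intro mult_mono weight_nonneg) auto
    then show ?thesis
      by (simp add: mult.assoc)
  qed
  have sums: "(\<Sum>k\<in>node_set N M n. ?a (fst k) * ?b (snd k)) \<le> S * S"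
  proof -
    have "(\<Sum>k\<in>node_set N M n. ?a (fst k) * ?b (snd k))
      = (\<Sum>k\<in>{0..int (n * N)}. ?a k) * (\<Sum>k\<in>{0..int (n * M)}. ?b k)"
      unfolding node_set_def by (simp add: sum_product sum.cartesian_product split_beta)
    also have "\<dots> \<le> S * S"
      unfolding S_def using S
      by (intro mult_mono sum_exp_dist_int_le) (auto intro: sum_nonneg simp: S_def)
    finally show ?thesis .
  qed
  have "f x - nn_operator \<sigma> N M n f x = (\<Sum>k\<in>node_set N M n. (f x - f (?p k)) * weight n x k) / ?W"
    using W(1) by (simp add: nn_operator_eq diff_divide_distrib left_diff_distrib sum_subtractf
        flip: sum_distrib_left)
  then have "\<bar>f x - nn_operator \<sigma> N M n f x\<bar> = \<bar>\<Sum>k\<in>node_set N M n. (f x - f (?p k)) * weight n x k\<bar> / ?W"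
    using W(1) by simp
  also have "\<dots> \<le> (\<Sum>k\<in>node_set N M n. \<bar>f x - f (?p k)\<bar> * weight n x k) / ?W"
    using W(1) by (intro divide_right_mono order_trans[OF sum_abs] sum_mono)
      (auto simp: abs_mult weight_nonneg)
  also have "\<dots> \<le> (\<Sum>k\<in>node_set N M n. B * C\<^sup>2 * E * (?a (fst k) * ?b (snd k))) / ?W"
    using W(1) by (intro divide_right_mono sum_mono term_le) auto
  also have "\<dots> \<le> (B * C\<^sup>2 * E * (S * S)) / ?W"
    unfolding sum_distrib_left[symmetric] using W(1) \<open>0 \<le> B\<close> E
    by (intro divide_right_mono mult_left_mono sums) auto
  also have "\<dots> \<le> (B * C\<^sup>2 * E * (S * S)) / phi_floor\<^sup>2"
    using W phi_floor_pos \<open>0 \<le> B\<close> E S by (intro divide_left_mono mult_nonneg_nonneg) auto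
  also have "\<dots> = B * localization_const * E"
    by (simp add: localization_const_def S_def[symmetric] power2_eq_square)
  finally show ?thesis
    by (simp add: E_def)
qed

lemma digital_image_mean_error:
  assumes f: "digital_image N M f" and "0 < N" "0 < M" "2 \<le> n"
  shows "(LINT x|image_measure N M. \<bar>f x - nn_operator \<sigma> N M n f x\<bar>)
    \<le> 255 * (8 * ln (real n) / real n + localization_const / real n)"
proof -
  interpret prob_space "image_measure N M"
    using assms by (simp add: prob_space_image_measure)
  define \<delta> where "\<delta> = 2 * ln (real n) / real n"
  define A where "A = {x \<in> image_domain N M. fst x \<in> strip N \<delta> \<or> snd x \<in> strip M \<delta>}"
  have "0 \<le> \<delta>"
    using assms by (simp add: \<delta>_def)
  note A = prob_strips[OF \<open>0 < N\<close> \<open>0 < M\<close> this, folded A_def]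
  have decay: "exp (- (real n * \<delta> / 2)) = 1 / real n"
    using assms by (simp add: \<delta>_def exp_minus inverse_eq_divide)
  have range_f: "f x \<in> {0..255}" if "x \<in> image_domain N M" for x
    using digital_image_range that assms by blast
  have "(LINT x|image_measure N M. \<bar>f x - nn_operator \<sigma> N M n f x\<bar>)
    \<le> 255 * prob A + 255 * localization_const * (1 / real n)"
  proof (rule expectation_abs_diff_le)
    show "f \<in> borel_measurable (image_measure N M)"
      using f by (rule digital_image_measurable)
    show "nn_operator \<sigma> N M n f \<in> borel_measurable (image_measure N M)"
      by (intro borel_imp_image_measure nn_operator_measurable)
    show "\<bar>f x - nn_operator \<sigma> N M n f x\<bar> \<le> 255" if "x \<in> space (image_measure N M)" for x
      using range_f[of x] nn_operator_range[of N M f 0 255 x n] range_f that assms by force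
    show "\<bar>f x - nn_operator \<sigma> N M n f x\<bar> \<le> 255 * localization_const * (1 / real n)"
      if "x \<in> space (image_measure N M) - A" for x
      unfolding decay[symmetric]
    proof (rule nn_operator_local_error)
      show x: "x \<in> image_domain N M"
        using that by simp
      show "\<bar>f x - f y\<bar> \<le> 255" if "y \<in> image_domain N M" for y
        using range_f[OF x] range_f[OF that] by auto
      show "f x = f y"
        if "y \<in> image_domain N M" "\<bar>fst x - fst y\<bar> < \<delta>" "\<bar>snd x - snd y\<bar> < \<delta>" for y
        using digital_image_locally_constant[OF f x that(1) _ _ that(2,3)]
          \<open>x \<in> space (image_measure N M) - A\<close> by (auto simp: A_def)
    qed (use assms in auto)
  qed (use A localization_const_nonneg in auto)
  also have "\<dots> \<le> 255 * (4 * \<delta>) + 255 * localization_const * (1 / real n)"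
    using A(2) by simp
  finally show ?thesis
    by (simp add: \<delta>_def algebra_simps)
qed

end

section \<open>The ramp and the logistic function\<close>

text \<open>
  The kernel of the ramp vanishes outside \<open>[-3/2, 3/2]\<close> and is at most \<open>1\<close>; the factor \<open>exp 2\<close> lifts
  the exponential above \<open>1\<close> on that interval.
\<close>

lemma decaying_sigmoid_ramp: "decaying_sigmoid ramp (exp 2)"
proof
  show "mono ramp"
    by (auto simp: mono_def ramp_def)
  show "phi ramp s \<le> exp 2 * exp (- \<bar>s\<bar>)" for s
  proof (cases "\<bar>s\<bar> \<le> 3 / 2")
    case True
    have "phi ramp s \<le> 1"
      by (simp add: phi_def ramp_def)
    also have "1 \<le> exp (2 - \<bar>s\<bar>)"
      using True by simp
    finally show ?thesis
      by (simp add: exp_diff exp_minus divide_inverse)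
  next
    case False
    then have "phi ramp s = 0"
      by (auto simp: phi_def ramp_def abs_if split: if_splits)
    then show ?thesis by simp
  qed
qed (simp add: ramp_def)

lemma logistic_tails:
  "0 \<le> logistic x" "logistic x \<le> 1" "logistic x \<le> exp x" "1 - exp (- x) \<le> logistic x"
proof -
  have p: "0 < exp (- x)" by simp
  show "0 \<le> logistic x" "logistic x \<le> 1"
    using p by (auto simp: logistic_def intro!: inverse_le_1_iff[THEN iffD2])
  have "inverse (1 + exp (- x)) \<le> inverse (exp (- x))"
    by (intro le_imp_inverse_le) auto
  then show "logistic x \<le> exp x"
    by (simp add: logistic_def exp_minus)
  have "(1 - exp (- x)) * (1 + exp (- x)) \<le> 1"
    by (simp add: algebra_simps)
  then show "1 - exp (- x) \<le> logistic x"
    using p by (simp add: logistic_def inverse_eq_divide pos_le_divide_eq add_pos_pos)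
qed

text \<open>
  The logistic function approaches its limits \<open>0\<close> and \<open>1\<close> exponentially. For \<open>s \<ge> 0\<close> the difference
  in the kernel is at most the distance of the lower value from \<open>1\<close>, for \<open>s \<le> 0\<close> at most the upper
  value. Shifting the argument by \<open>1\<close> costs a factor \<open>exp 1\<close>; the weaker \<open>exp 2\<close> is the constant
  of the ramp.
\<close>

lemma decaying_sigmoid_logistic: "decaying_sigmoid logistic (exp 2)"
proof
  show "mono logistic"
    by (auto simp: mono_def logistic_def intro!: le_imp_inverse_le add_pos_pos)
  have "inverse (1 + exp (- 0)) < inverse (1 + exp (- 1 :: real))"
    by (intro less_imp_inverse_less add_pos_pos) simp_all
  then show "logistic 0 < logistic 1"
    by (simp only: logistic_def)
  show "phi logistic s \<le> exp 2 * exp (- \<bar>s\<bar>)" for s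
  proof -
    have "logistic (s + 1) - logistic (s - 1) \<le> exp (s + 1)"
      using logistic_tails(1)[of "s - 1"] logistic_tails(3)[of "s + 1"] by linarith
    moreover have "logistic (s + 1) - logistic (s - 1) \<le> exp (1 - s)"
      using logistic_tails(2)[of "s + 1"] logistic_tails(4)[of "s - 1"] by simp
    ultimately have "logistic (s + 1) - logistic (s - 1) \<le> exp (1 - \<bar>s\<bar>)"
      by (cases "0 \<le> s") (auto simp: add.commute)
    also have "\<dots> \<le> exp (2 - \<bar>s\<bar>)"
      by simp
    finally have "phi logistic s \<le> 1 / 2 * exp (2 - \<bar>s\<bar>)"
      by (simp add: phi_def)
    also have "\<dots> \<le> exp (2 - \<bar>s\<bar>)"
      by simp
    finally show ?thesis
      by (simp add: exp_diff exp_minus divide_inverse)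
  qed
qed

section \<open>The similarity estimate for the operators\<close>

text \<open>
  From \<open>n = 3\<close> on, \<open>ln n \<ge> 1\<close>, so the localization error of order \<open>1/n\<close> is absorbed into
  \<open>ln n / n\<close>.
\<close>

lemma (in decaying_sigmoid) cSSIM_nn_operator_bound:
  assumes f: "digital_image N M f" and "0 < N" "0 < M" "0 < c\<^sub>1" "0 < c\<^sub>2" "3 \<le> n"
  shows "\<bar>1 - cSSIM c\<^sub>1 c\<^sub>2 N M f (nn_operator \<sigma> N M n f)\<bar>
    \<le> cSSIM_const c\<^sub>1 c\<^sub>2 N M f * 255\<^sup>2 * (8 + localization_const) * (ln (real n) / real n)"
proof -
  let ?E = "LINT x|image_measure N M. \<bar>f x - nn_operator \<sigma> N M n f x\<bar>"
  have range_f: "f x \<in> {0..255}" if "x \<in> image_domain N M" for x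
    using digital_image_range that assms by blast
  have "0 \<le> img_var N M f"
    unfolding img_var_def img_cov_def by (intro integral_nonneg_AE AE_I2) simp
  then have const: "0 \<le> cSSIM_const c\<^sub>1 c\<^sub>2 N M f"
    unfolding cSSIM_const_def using assms by (intro add_nonneg_nonneg divide_nonneg_nonneg) auto
  have "1 \<le> ln (real n)"
    using exp_le \<open>3 \<le> n\<close> by (subst ln_ge_iff) auto
  then have "localization_const / real n \<le> localization_const * ln (real n) / real n"
    using localization_const_nonneg by (intro divide_right_mono) (auto simp: mult_le_cancel_left1)
  then have "8 * ln (real n) / real n + localization_const / real n
      \<le> (8 + localization_const) * (ln (real n) / real n)"
    by (simp add: algebra_simps)
  then have E: "?E \<le> 255 * ((8 + localization_const) * (ln (real n) / real n))"
    using \<open>3 \<le> n\<close> by (intro order_trans[OF digital_image_mean_error[OF f]] mult_left_mono assms) auto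
  have "\<bar>1 - cSSIM c\<^sub>1 c\<^sub>2 N M f (nn_operator \<sigma> N M n f)\<bar> \<le> cSSIM_const c\<^sub>1 c\<^sub>2 N M f * (255 * ?E)"
  proof (rule one_minus_cSSIM_le)
    show "nn_operator \<sigma> N M n f x \<in> {0..255}" if "x \<in> image_domain N M" for x
      using nn_operator_range[OF range_f that] \<open>3 \<le> n\<close> by simp
  qed (use assms range_f in \<open>auto intro: digital_image_measurable borel_imp_image_measure nn_operator_measurable\<close>)
  also have "\<dots> \<le> cSSIM_const c\<^sub>1 c\<^sub>2 N M f * (255 * (255 * ((8 + localization_const) * (ln (real n) / real n))))"
    using const E by (intro mult_left_mono) auto
  finally show ?thesis
    by (simp add: power2_eq_square mult_ac)
qed

theorem corollary23:
  fixes \<sigma> :: "real \<Rightarrow> real"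
    and N M :: nat
    and f :: "real \<times> real \<Rightarrow> real"
    and c\<^sub>1 c\<^sub>2 :: real
  assumes "\<sigma> = ramp \<or> \<sigma> = logistic"
    and "N > 0" and "M > 0"
    and "c\<^sub>1 > 0" and "c\<^sub>2 > 0"
    and "digital_image N M f"
  shows "\<exists>K>0. \<forall>\<^sub>F n in sequentially.
    \<bar>1 - cSSIM c\<^sub>1 c\<^sub>2 N M f (nn_operator \<sigma> N M n f)\<bar>
      \<le> cSSIM_const c\<^sub>1 c\<^sub>2 N M f * 255\<^sup>2 * real M * real N * K * (ln (real n) / real n)"
proof -
  have "decaying_sigmoid \<sigma> (exp 2)"
    using assms(1) decaying_sigmoid_ramp decaying_sigmoid_logistic by blast
  then interpret decaying_sigmoid \<sigma> "exp 2" .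
  let ?K = "8 + localization_const"
  have K: "0 < ?K"
    using localization_const_nonneg by simp
  \<comment> \<open>inserting the area of the rectangle only enlarges the bound, because \<open>N\<close> and \<open>M\<close> are positive integers\<close>
  have "1 \<le> real M * real N"
    using assms mult_mono[of 1 "real M" 1 "real N"] by simp
  then have area: "T \<le> (real M * real N) * T" if "0 \<le> T" for T
    using mult_right_mono[OF _ that, of 1] by simp
  have "\<bar>1 - cSSIM c\<^sub>1 c\<^sub>2 N M f (nn_operator \<sigma> N M n f)\<bar>
      \<le> cSSIM_const c\<^sub>1 c\<^sub>2 N M f * 255\<^sup>2 * real M * real N * ?K * (ln (real n) / real n)"
    if "3 \<le> n" for n
  proof -
    let ?T = "cSSIM_const c\<^sub>1 c\<^sub>2 N M f * 255\<^sup>2 * ?K * (ln (real n) / real n)"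
    have le: "\<bar>1 - cSSIM c\<^sub>1 c\<^sub>2 N M f (nn_operator \<sigma> N M n f)\<bar> \<le> ?T"
      using assms that by (intro cSSIM_nn_operator_bound) auto
    then have "0 \<le> ?T"
      by (rule order_trans[OF abs_ge_zero])
    from le area[OF this] show ?thesis
      by (simp add: mult_ac)
  qed
  then show ?thesis
    using K by (intro exI[of _ ?K] conjI eventually_sequentiallyI[of 3]) auto
qed

end
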